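(* Let $d,N\in\mathbb{N}$ with $d,N>1$, and let $p\ge1$ ($p<\infty$). Then the semimetric $\widetilde{\mathcal{KR}}_p$ on $\mathcal{P}_p((\mathbb{R}^d)^N)$ does not satisfy the triangle inequality; that is, there are $\mu,\nu,\eta\in\mathcal{P}_p((\mathbb{R}^d)^N)$ with $\widetilde{\mathcal{KR}}_p(\mu,\eta)>\widetilde{\mathcal{KR}}_p(\mu,\nu)+\widetilde{\mathcal{KR}}_p(\nu,\eta)$.
   Context: $|x|_p^p:=\sum_i|x_i|^p$ (sum over all real coordinates), $\mathcal{P}_p((\mathbb{R}^d)^N)$ is the set of Borel probability measures on $(\mathbb{R}^d)^N$ with finite $p$-th moment, $\Pi(\mu,\nu)$ is the set of couplings of $\mu$ and $\nu$, and $\mathcal{W}_p$ is the $p$-Wasserstein distance on $\mathcal{P}_p(\mathbb{R}^d)$ with cost $|x-y|_p^p$. For $\mu\in\mathcal{P}_p((\mathbb{R}^d)^N)$ write its successive disintegration as $\mu(dx)=\mu_1(dx_1)\mu_2^{x_1}(dx_2)\cdots\mu_N^{x_1,\dots,x_{N-1}}(dx_N)$ with $x_k\in\mathbb{R}^d$; for $\pi\in\Pi(\mu,\nu)$ write $\pi=\pi_1(dx_1,dy_1)\,\pi_2^{x_1,y_1}(dx_2,dy_2)\cdots$ with $x_k,y_k\in\mathbb{R}^d$. $\pi\in\Pi(\mu,\nu)$ is triangular optimal, $\pi\in\Pi_{\rm to}(\mu,\nu)$, if $\pi$-a.s., for all $k\le N$, $\pi_k^{x_1,\dots,x_{k-1},y_1,\dots,y_{k-1}}$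 is a $\mathcal{W}_p$-optimal coupling between $\mu_k^{x_1,\dots,x_{k-1}}$ and $\nu_k^{y_1,\dots,y_{k-1}}$. Define $$\widetilde{\mathcal{KR}}_p(\mu,\nu):=\sup_{\pi\in\Pi_{\rm to}(\mu,\nu)}\Big(\int|x-y|_p^p\,d\pi(x,y)\Big)^{1/p}.$$ *)

theory Defs
  imports "HOL-Probability.Probability"
begin

text \<open>
  A point of \<open>(\<real>\<^sup>d)\<^sup>N\<close> is an extensional function \<open>{0..<N} \<Rightarrow> \<real>\<^sup>d\<close> (so time indices
  start at 0), and Borel measures on \<open>(\<real>\<^sup>d)\<^sup>N\<close> are measures on the following product space,
  whose sigma-algebra is the Borel one because \<open>\<real>\<^sup>d\<close> is second countable.
\<close>

abbreviation paths :: "nat \<Rightarrow> (nat \<Rightarrow> 'a::topological_space) measure" where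
  "paths N \<equiv> PiM {0..<N} (\<lambda>_. borel)"

definition pnormp :: "real \<Rightarrow> real ^ 'd \<Rightarrow> real" where
  "pnormp p v = (\<Sum>j\<in>UNIV. \<bar>v $ j\<bar> powr p)"

definition path_pnormp :: "nat \<Rightarrow> real \<Rightarrow> (nat \<Rightarrow> real ^ 'd) \<Rightarrow> real" where
  "path_pnormp N p x = (\<Sum>i<N. pnormp p (x i))"

definition Pp :: "nat \<Rightarrow> real \<Rightarrow> (nat \<Rightarrow> real ^ 'd) measure set" where
  "Pp N p = {\<mu>. prob_space \<mu> \<and> sets \<mu> = sets (paths N) \<and>
                 (\<integral>\<^sup>+ x. ennreal (path_pnormp N p x) \<partial>\<mu>) < \<infinity>}"

definition couplings :: "'a measure \<Rightarrow> 'b measure \<Rightarrow> ('a \<times> 'b) measure set" where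
  "couplings \<mu> \<nu> = {\<pi>. sets \<pi> = sets (\<mu> \<Otimes>\<^sub>M \<nu>) \<and> distr \<pi> \<mu> fst = \<mu> \<and> distr \<pi> \<nu> snd = \<nu>}"

definition eroot :: "real \<Rightarrow> ennreal \<Rightarrow> ennreal" where
  "eroot p a = (if a = \<infinity> then \<infinity> else ennreal (enn2real a powr (1 / p)))"

definition Wp :: "real \<Rightarrow> (real ^ 'd) measure \<Rightarrow> (real ^ 'd) measure \<Rightarrow> ennreal" where
  "Wp p \<alpha> \<beta> = (INF \<gamma>\<in>couplings \<alpha> \<beta>. eroot p (\<integral>\<^sup>+ (x, y). ennreal (pnormp p (x - y)) \<partial>\<gamma>))"

definition Wp_optimal ::
    "real \<Rightarrow> (real ^ 'd) measure \<Rightarrow> (real ^ 'd) measure \<Rightarrow> ((real ^ 'd) \<times> (real ^ 'd)) measure \<Rightarrow> bool" where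
  "Wp_optimal p \<alpha> \<beta> \<gamma> \<longleftrightarrow>
     \<gamma> \<in> couplings \<alpha> \<beta> \<and> eroot p (\<integral>\<^sup>+ (x, y). ennreal (pnormp p (x - y)) \<partial>\<gamma>) = Wp p \<alpha> \<beta>"

text \<open>
  \<open>K k x\<close> is the conditional law of the coordinate \<open>k\<close> given the coordinates \<open>x\<close> with indices
  below \<open>k\<close>. The locale predicate says that every \<open>K k\<close> is a measurable probability kernel, and
  \<open>C 0 N\<close> is the composition \<open>K 0 (dx\<^sub>0) K 1 x\<^sub>0 (dx\<^sub>1) \<dots>\<close> of the first \<open>N\<close> kernels,
  started from the empty history; the kernels with index \<open>\<ge> N\<close> play no role.
\<close>

definition disintegration ::
    "nat \<Rightarrow> (nat \<Rightarrow> 'a::topological_space) measure \<Rightarrow> (nat \<Rightarrow> (nat \<Rightarrow> 'a) \<Rightarrow> 'a measure) \<Rightarrow> bool" where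
  "disintegration N \<mu> K \<longleftrightarrow>
     Ionescu_Tulcea K (\<lambda>_. borel) \<and>
     \<mu> = Ionescu_Tulcea.C K (\<lambda>_. borel) 0 N (\<lambda>_. undefined)"

text \<open>The pair of paths \<open>(x, y)\<close>, cut at time \<open>k\<close>, as the path of pairs \<open>(x\<^sub>i, y\<^sub>i)\<close>.\<close>

definition zip_paths :: "nat \<Rightarrow> (nat \<Rightarrow> 'a) \<times> (nat \<Rightarrow> 'b) \<Rightarrow> nat \<Rightarrow> 'a \<times> 'b" where
  "zip_paths k = (\<lambda>(x, y). \<lambda>i\<in>{0..<k}. (x i, y i))"

text \<open>
  Disintegrations exist and are almost surely unique, and the marginals of \<open>\<pi>\<close> are \<open>\<mu>\<close> and \<open>\<nu>\<close>;
  hence the condition below does not depend on which versions of the kernels are chosen.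
\<close>

definition triangular_optimal ::
    "nat \<Rightarrow> real \<Rightarrow> (nat \<Rightarrow> real ^ 'd) measure \<Rightarrow> (nat \<Rightarrow> real ^ 'd) measure \<Rightarrow>
     ((nat \<Rightarrow> real ^ 'd) \<times> (nat \<Rightarrow> real ^ 'd)) measure set" where
  "triangular_optimal N p \<mu> \<nu> = {\<pi> \<in> couplings \<mu> \<nu>. \<exists>K\<^sub>\<mu> K\<^sub>\<nu> K\<^sub>\<pi>.
     disintegration N \<mu> K\<^sub>\<mu> \<and> disintegration N \<nu> K\<^sub>\<nu> \<and>
     disintegration N (distr \<pi> (paths N) (zip_paths N)) K\<^sub>\<pi> \<and>
     (AE (x, y) in \<pi>. \<forall>k<N.
        Wp_optimal p (K\<^sub>\<mu> k (restrict x {0..<k})) (K\<^sub>\<nu> k (restrict y {0..<k}))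
          (K\<^sub>\<pi> k (zip_paths k (x, y))))}"

definition KRp :: "nat \<Rightarrow> real \<Rightarrow> (nat \<Rightarrow> real ^ 'd) measure \<Rightarrow> (nat \<Rightarrow> real ^ 'd) measure \<Rightarrow> ennreal" where
  "KRp N p \<mu> \<nu> = (SUP \<pi>\<in>triangular_optimal N p \<mu> \<nu>.
     eroot p (\<integral>\<^sup>+ (x, y). ennreal (path_pnormp N p (\<lambda>i. x i - y i)) \<partial>\<pi>))"

end

theory Submission
  imports Defs
begin

text \<open>
  Let \<open>e\<^sub>1, e\<^sub>2\<close> be two coordinate vectors, \<open>s\<close> a fair sign, and take for \<open>\<mu>, \<nu>, \<eta>\<close> the laws of the
  paths with first point \<open>s u\<close> and all later points \<open>s e\<^sub>1\<close>, where \<open>u\<close> is \<open>e\<^sub>1\<close>, \<open>(e\<^sub>1 + e\<^sub>2) / 2\<close> and \<open>e\<^sub>2\<close>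
  respectively. Every coupling of \<open>\<plusminus>e\<^sub>1\<close> with \<open>\<plusminus>e\<^sub>2\<close> is optimal, so a triangular optimal coupling of
  \<open>\<mu>\<close> and \<open>\<eta>\<close> may match opposite signs, at total cost \<open>2 + (N - 1) 2\<^sup>p\<close>. Passing through the
  midpoint makes the optimal coupling of the first points unique: it matches equal signs, the later
  points then coincide, and each of the two steps costs only \<open>2 (1/2)\<^sup>p\<close>.
\<close>

section \<open>Laws of paths determined by their first point\<close>

definition flow :: "nat \<Rightarrow> ('a \<Rightarrow> 'a) \<Rightarrow> 'a \<Rightarrow> nat \<Rightarrow> 'a" where
  "flow N g a = (\<lambda>i\<in>{0..<N}. if i = 0 then a else g a)"

text \<open>These serve as explicit kernels for the law of a flow whose first point is drawn from
  \<open>\<alpha>\<close>. The state space stays a general topological space, so that the same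
  kernels also describe paths of pairs.\<close>

definition flow_kernel ::
    "'a::topological_space measure \<Rightarrow> ('a \<Rightarrow> 'a) \<Rightarrow> nat \<Rightarrow> (nat \<Rightarrow> 'a) \<Rightarrow> 'a measure" where
  "flow_kernel \<alpha> g k x = (if k = 0 then \<alpha> else return borel (g (x 0)))"

lemma measurable_flow [measurable (raw)]:
  assumes [measurable]: "g \<in> borel \<rightarrow>\<^sub>M borel" "f \<in> M \<rightarrow>\<^sub>M borel"
  shows "(\<lambda>x. flow N g (f x)) \<in> M \<rightarrow>\<^sub>M paths N"
  unfolding flow_def by (rule measurable_restrict) auto

text \<open>Appending a Dirac kernel at \<open>g\<close> of the first point turns the law of the
  flow of one length into that of the next length. Explicit disintegrations of this kind give the
  existence part of triangular optimality in \<open>KRp_sgn_flow_ge\<close>.\<close>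

lemma disintegration_flow:
  assumes \<alpha>: "prob_space \<alpha>" "sets \<alpha> = sets borel"
    and g [measurable]: "g \<in> borel \<rightarrow>\<^sub>M borel" and "0 < N"
  shows "disintegration N (distr \<alpha> (paths N) (flow N g)) (flow_kernel \<alpha> g)"
proof -
  note \<alpha>(2)[measurable_cong]
  have sp: "space \<alpha> = UNIV"
    using sets_eq_imp_space_eq[OF \<alpha>(2)] by simp
  interpret IT: Ionescu_Tulcea "flow_kernel \<alpha> g" "\<lambda>_. borel"
  proof (rule Ionescu_Tulcea.intro)
    show "flow_kernel \<alpha> g i \<in> paths i \<rightarrow>\<^sub>M subprob_algebra borel" for i
    proof (cases "i = 0")
      case True
      have "\<alpha> \<in> space (subprob_algebra borel)"
        using \<alpha> by (simp add: space_subprob_algebra prob_space_imp_subprob_space)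
      with True show ?thesis
        by (simp add: flow_kernel_def[abs_def])
    next
      case False
      then have [measurable]: "(\<lambda>x. x 0) \<in> paths i \<rightarrow>\<^sub>M borel"
        by (intro measurable_component_singleton) auto
      from False show ?thesis
        by (simp add: flow_kernel_def[abs_def])
    qed
    show "prob_space (flow_kernel \<alpha> g i x)" if "x \<in> space (paths i)" for i x
      using \<alpha> by (auto simp: flow_kernel_def intro: prob_space_return)
  qed
  \<comment> \<open>The only random transition is the one from the empty history, so the induction
    starts at length one; every later step appends a Dirac mass.\<close>
  have "IT.C 0 (Suc m) (\<lambda>_. undefined) = distr \<alpha> (paths (Suc m)) (flow (Suc m) g)" for m
  proof (induction m)
    case 0
    have "IT.C 0 (Suc 0) (\<lambda>_. undefined) = IT.eP 0 (\<lambda>_. undefined)"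
      using bind_return[OF IT.measurable_eP, of "\<lambda>_. undefined" 0] by simp
    also have "\<dots> = distr \<alpha> (paths (Suc 0)) (flow (Suc 0) g)"
      unfolding IT.eP_def
      by (rule distr_cong) (auto simp: flow_kernel_def flow_def fun_eq_iff)
    finally show ?case .
  next
    case (Suc m)
    have eP: "IT.eP (Suc m) (flow (Suc m) g a) = return (paths (Suc (Suc m))) (flow (Suc (Suc m)) g a)" for a
    proof -
      have "IT.eP (Suc m) (flow (Suc m) g a) = distr (return borel (g a)) (paths (Suc (Suc m))) (fun_upd (flow (Suc m) g a) (Suc m))"
        by (simp add: IT.eP_def flow_kernel_def flow_def)
      also have "\<dots> = return (paths (Suc (Suc m))) (fun_upd (flow (Suc m) g a) (Suc m) (g a))"
        by (intro distr_return measurable_fun_upd[where J="{0..<Suc m}"])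
           (auto simp: flow_def space_PiM)
      also have "fun_upd (flow (Suc m) g a) (Suc m) (g a) = flow (Suc (Suc m)) g a"
        by (auto simp: flow_def fun_eq_iff)
      finally show ?thesis .
    qed
    have "IT.C 0 (Suc (Suc m)) (\<lambda>_. undefined)
        = distr \<alpha> (paths (Suc m)) (flow (Suc m) g) \<bind> IT.eP (Suc m)"
      using Suc by simp
    \<comment> \<open>Pulled back to \<open>\<alpha>\<close>, the composition binds a point mass
      depending on \<open>a\<close>, which is an image measure.\<close>
    also have "\<dots> = \<alpha> \<bind> (\<lambda>a. IT.eP (Suc m) (flow (Suc m) g a))"
      by (rule bind_distr[OF _ IT.measurable_eP]) (auto simp: sp)
    also have "\<dots> = distr \<alpha> (paths (Suc (Suc m))) (flow (Suc (Suc m)) g)"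
      unfolding eP by (rule bind_return_distr') (auto simp: sp)
    finally show ?case .
  qed
  from this[of "N - 1"] \<open>0 < N\<close> show ?thesis
    unfolding disintegration_def using IT.Ionescu_Tulcea_axioms by simp
qed

text \<open>Restricting the composed kernels to the first coordinate leaves only the kernel at time
  0. There is a single empty history, so this kernel is determined exactly and not just almost
  surely; any version provided by an existential quantifier is therefore known at time 0.\<close>

lemma disintegration_first_marginal:
  assumes "disintegration N \<mu> K" "0 < N"
  shows "K 0 (\<lambda>_. undefined) = distr \<mu> borel (\<lambda>x. x 0)"
proof -
  interpret IT: Ionescu_Tulcea K "\<lambda>_. borel"
    using assms by (simp add: disintegration_def)
  let ?u = "\<lambda>_. undefined"
  have \<mu>: "\<mu> = IT.C 0 N ?u"
    using assms by (simp add: disintegration_def)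
  have sets_\<mu> [measurable_cong]: "sets \<mu> = sets (paths N)"
    unfolding \<mu> using IT.sets_C[of ?u 0 N] by simp
  have K_sets [measurable_cong]: "sets (K 0 ?u) = sets borel"
    using IT.sets_P[of ?u 0] by simp
  have first: "(\<lambda>x. x 0) \<in> paths n \<rightarrow>\<^sub>M borel" if "0 < n" for n
    using that by (intro measurable_component_singleton) auto
  have res: "(\<lambda>x. restrict x {0..<Suc 0}) \<in> paths N \<rightarrow>\<^sub>M paths (Suc 0)"
    using \<open>0 < N\<close> by (intro measurable_restrict_subset) auto
  have upd: "fun_upd ?u 0 \<in> borel \<rightarrow>\<^sub>M paths (Suc 0)"
    by (intro measurable_fun_upd[where J="{}"]) auto
  have "IT.eP 0 ?u = IT.C 0 (Suc 0) ?u"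
    using bind_return[OF IT.measurable_eP, of ?u 0] by simp
  also have "\<dots> = distr \<mu> (paths (Suc 0)) (\<lambda>x. restrict x {0..<Suc 0})"
    using IT.distr_C[of "Suc 0" N ?u 0] \<open>0 < N\<close> by (simp add: \<mu>)
  finally have "distr (IT.eP 0 ?u) borel (\<lambda>x. x 0)
      = distr (distr \<mu> (paths (Suc 0)) (\<lambda>x. restrict x {0..<Suc 0})) borel (\<lambda>x. x 0)"
    by simp
  also have "\<dots> = distr \<mu> borel (\<lambda>x. x 0)"
    using res first[of "Suc 0"] by (subst distr_distr) (auto simp: comp_def measurable_cong_sets[OF sets_\<mu> refl])
  also have "distr (IT.eP 0 ?u) borel (\<lambda>x. x 0) = distr (K 0 ?u) borel (\<lambda>x. x)"
    unfolding IT.eP_def using upd first[of "Suc 0"]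
    by (subst distr_distr) (auto simp: comp_def measurable_cong_sets[OF K_sets refl])
  also have "\<dots> = K 0 ?u"
    by (rule distr_id2) (simp add: K_sets)
  finally show ?thesis .
qed

lemma measurable_zip_paths [measurable]:
  "zip_paths N \<in> paths N \<Otimes>\<^sub>M paths N \<rightarrow>\<^sub>M
    (paths N :: (nat \<Rightarrow> 'a::second_countable_topology \<times> 'b::second_countable_topology) measure)"
  unfolding zip_paths_def borel_prod[symmetric] by measurable

section \<open>The cost function, its root and equality in an integral bound\<close>

lemma pnormp_nonneg [simp]: "0 \<le> pnormp p v"
  by (simp add: pnormp_def sum_nonneg)

lemma pnormp_zero [simp]: "pnormp p 0 = 0"
  by (simp add: pnormp_def)

lemma pnormp_minus [simp]: "pnormp p (- v) = pnormp p v"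
  by (simp add: pnormp_def)

lemma pnormp_diff_commute: "pnormp p (v - w) = pnormp p (w - v)"
  using pnormp_minus[of p "v - w"] by simp

lemma pnormp_axis2:
  assumes "i \<noteq> j"
  shows "pnormp p (a *\<^sub>R axis i 1 + b *\<^sub>R axis j 1) = \<bar>a\<bar> powr p + \<bar>b\<bar> powr p"
proof -
  have "pnormp p (a *\<^sub>R axis i 1 + b *\<^sub>R axis j 1)
      = (\<Sum>k\<in>UNIV. (if k = i then \<bar>a\<bar> powr p else 0) + (if k = j then \<bar>b\<bar> powr p else 0))"
    unfolding pnormp_def using assms by (intro sum.cong) (auto simp: axis_def)
  then show ?thesis by (simp add: sum.distrib)
qed

lemma measurable_pnormp [measurable]: "pnormp p \<in> borel_measurable borel"
  unfolding pnormp_def[abs_def] by measurable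

lemma eroot_ennreal: "0 \<le> a \<Longrightarrow> eroot p (ennreal a) = ennreal (a powr (1 / p))"
  by (simp add: eroot_def)

text \<open>Optimality compares roots of costs, while the upper bound needs the costs themselves. An
  infinite \<open>a\<close> is excluded because its root is infinite too.\<close>

lemma le_if_eroot_le:
  assumes "0 < p" "eroot p a \<le> eroot p (ennreal c)" "0 \<le> c"
  shows "a \<le> ennreal c"
proof (cases a)
  case (real r)
  then have "r powr (1 / p) \<le> c powr (1 / p)"
    using assms by (simp add: eroot_ennreal)
  then have "r \<le> c"
    using assms real by (meson not_le powr_less_mono2 divide_pos_pos zero_less_one)
  with real show ?thesis by (simp add: ennreal_leI)
qed (use assms in \<open>simp_all add: eroot_def top_unique\<close>)

text \<open>The excess \<open>f x - ennreal c\<close> has integral zero. This converts minimality of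
  a total cost into a pointwise statement.\<close>

lemma (in prob_space) AE_eq_if_nn_integral_le:
  assumes [measurable]: "f \<in> borel_measurable M"
    and ge: "AE x in M. ennreal c \<le> f x" and le: "(\<integral>\<^sup>+ x. f x \<partial>M) \<le> ennreal c"
  shows "AE x in M. f x = ennreal c"
proof -
  have "(\<integral>\<^sup>+ x. f x - ennreal c \<partial>M) = (\<integral>\<^sup>+ x. f x \<partial>M) - (\<integral>\<^sup>+ x. ennreal c \<partial>M)"
    using ge by (intro nn_integral_diff) (auto simp: emeasure_space_1)
  also have "\<dots> = 0"
    using le by (simp add: emeasure_space_1 diff_eq_0_iff_ennreal order_le_less_trans)
  finally have "AE x in M. f x - ennreal c = 0"
    by (subst (asm) nn_integral_0_iff_AE) auto
  with ge show ?thesis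
    by eventually_elim (auto simp: diff_eq_0_iff_ennreal intro: antisym)
qed

section \<open>Couplings and a criterion for optimality\<close>

lemma couplings_AE:
  assumes "\<pi> \<in> couplings \<mu> \<nu>" "AE x in \<mu>. P x" "AE y in \<nu>. Q y"
  shows "AE z in \<pi>. P (fst z) \<and> Q (snd z)"
proof -
  have \<pi>: "sets \<pi> = sets (\<mu> \<Otimes>\<^sub>M \<nu>)" "distr \<pi> \<mu> fst = \<mu>" "distr \<pi> \<nu> snd = \<nu>"
    using assms(1) by (auto simp: couplings_def)
  have m: "fst \<in> \<pi> \<rightarrow>\<^sub>M \<mu>" "snd \<in> \<pi> \<rightarrow>\<^sub>M \<nu>"
    by (simp_all add: measurable_cong_sets[OF \<pi>(1) refl])
  have "AE z in \<pi>. P (fst z)"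
    by (rule AE_distrD[OF m(1)]) (subst \<pi>(2), rule assms)
  moreover have "AE z in \<pi>. Q (snd z)"
    by (rule AE_distrD[OF m(2)]) (subst \<pi>(3), rule assms)
  ultimately show ?thesis by eventually_elim simp
qed

lemma distr_Pair_in_couplings:
  assumes f: "f \<in> M \<rightarrow>\<^sub>M A" "distr M A f = \<mu>"
    and g: "g \<in> M \<rightarrow>\<^sub>M B" "distr M B g = \<nu>"
  shows "distr M (A \<Otimes>\<^sub>M B) (\<lambda>s. (f s, g s)) \<in> couplings \<mu> \<nu>"
proof -
  let ?\<pi> = "distr M (A \<Otimes>\<^sub>M B) (\<lambda>s. (f s, g s))"
  note f(1)[measurable] g(1)[measurable]
  have sets: "sets \<mu> = sets A" "sets \<nu> = sets B"
    using f(2) g(2) by auto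
  have "distr ?\<pi> A fst = \<mu>" "distr ?\<pi> B snd = \<nu>"
    unfolding f(2)[symmetric] g(2)[symmetric] by (subst distr_distr; simp add: comp_def)+
  \<comment> \<open>\<open>couplings\<close> takes the marginals with targets \<open>\<mu>\<close>
    and \<open>\<nu>\<close>; a pushforward depends on its target only through the
    sigma-algebra.\<close>
  moreover have "distr ?\<pi> \<mu> fst = distr ?\<pi> A fst" "distr ?\<pi> \<nu> snd = distr ?\<pi> B snd"
    by (intro distr_cong; simp add: sets)+
  ultimately show ?thesis
    by (simp add: couplings_def sets cong: sets_pair_measure_cong)
qed

lemma prob_space_coupling:
  assumes "\<pi> \<in> couplings \<mu> \<nu>" "prob_space \<mu>"
  shows "prob_space \<pi>"
proof (rule prob_space_distrD)
  show "fst \<in> \<pi> \<rightarrow>\<^sub>M \<mu>" "prob_space (distr \<pi> \<mu> fst)"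
    using assms by (auto simp: couplings_def cong: measurable_cong_sets)
qed

text \<open>All couplings have the same cost, so each of them attains the infimum. This covers
  opposite signs at time 0 as well as the Dirac masses at later times.\<close>

lemma Wp_optimal_if_cost_constant:
  assumes \<gamma>: "\<gamma> \<in> couplings \<alpha> \<beta>" and "prob_space \<alpha>"
    and A: "AE x in \<alpha>. x \<in> A" and B: "AE y in \<beta>. y \<in> B"
    and c: "\<And>x y. x \<in> A \<Longrightarrow> y \<in> B \<Longrightarrow> pnormp p (x - y) = c"
  shows "Wp_optimal p \<alpha> \<beta> \<gamma>"
proof -
  have *: "(\<integral>\<^sup>+ (x, y). ennreal (pnormp p (x - y)) \<partial>\<gamma>') = ennreal c" if "\<gamma>' \<in> couplings \<alpha> \<beta>" for \<gamma>'
  proof -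
    interpret prob_space \<gamma>'
      using that \<open>prob_space \<alpha>\<close> by (rule prob_space_coupling)
    have "(\<integral>\<^sup>+ (x, y). ennreal (pnormp p (x - y)) \<partial>\<gamma>') = (\<integral>\<^sup>+ z. ennreal c \<partial>\<gamma>')"
      using couplings_AE[OF that A B]
      by (intro nn_integral_cong_AE, elim eventually_mono) (auto simp: c split_beta)
    then show ?thesis by (simp add: emeasure_space_1)
  qed
  then have "Wp p \<alpha> \<beta> = (INF \<gamma>'\<in>couplings \<alpha> \<beta>. eroot p (ennreal c))"
    unfolding Wp_def by (intro INF_cong) auto
  also have "\<dots> = eroot p (ennreal c)"
    using \<gamma> by (intro cINF_const) auto
  finally show ?thesis
    using \<gamma> * by (simp add: Wp_optimal_def)
qed

section \<open>Symmetric two-point laws and the paths they drive\<close>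

definition sgn_pmf :: "real pmf" where
  "sgn_pmf = pmf_of_set {-1, 1}"

lemma set_sgn_pmf [simp]: "set_pmf sgn_pmf = {-1, 1}"
  by (simp add: sgn_pmf_def)

lemma map_pmf_uminus_sgn_pmf: "map_pmf uminus sgn_pmf = sgn_pmf"
  unfolding sgn_pmf_def by (subst map_pmf_of_set_inj) (auto simp: insert_commute)

text \<open>The presentation as an image of a random sign lets one sign drive two laws at once,
  which is how the couplings below are built.\<close>

definition sgn_law :: "'a \<Rightarrow> 'a::real_normed_vector measure" where
  "sgn_law u = distr (measure_pmf sgn_pmf) borel (\<lambda>s. s *\<^sub>R u)"

lemma prob_space_sgn_law: "prob_space (sgn_law u)"
  unfolding sgn_law_def by (intro prob_space.prob_space_distr prob_space_measure_pmf) simp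

lemma sets_sgn_law [simp, measurable_cong]: "sets (sgn_law u) = sets borel"
  by (simp add: sgn_law_def)

text \<open>A fair sign is symmetric. Hence flipping the sign on one side of a coupling preserves
  that marginal.\<close>

lemma sgn_law_uminus: "distr (measure_pmf sgn_pmf) borel (\<lambda>s. - (s *\<^sub>R u)) = sgn_law u"
proof -
  have "sgn_law u = distr (measure_pmf (map_pmf uminus sgn_pmf)) borel (\<lambda>s. s *\<^sub>R u)"
    by (simp add: sgn_law_def map_pmf_uminus_sgn_pmf)
  also have "\<dots> = distr (measure_pmf sgn_pmf) borel (\<lambda>s. - (s *\<^sub>R u))"
    unfolding map_pmf_rep_eq by (subst distr_distr) (simp_all add: comp_def)
  finally show ?thesis by simp
qed

lemma AE_sgn_law: "AE x in sgn_law u. x \<in> {u, - u}"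
  unfolding sgn_law_def by (subst AE_distr_iff) (auto simp: AE_measure_pmf_iff)

definition sgn_flow :: "nat \<Rightarrow> ('a \<Rightarrow> 'a) \<Rightarrow> 'a \<Rightarrow> (nat \<Rightarrow> 'a::real_normed_vector) measure" where
  "sgn_flow N g u = distr (sgn_law u) (paths N) (flow N g)"

lemma sets_sgn_flow [simp, measurable_cong]: "sets (sgn_flow N g u) = sets (paths N)"
  by (simp add: sgn_flow_def)

context
  fixes N :: nat and g :: "real ^ 'd \<Rightarrow> real ^ 'd" and p :: real
  assumes N: "0 < N" and g [measurable]: "g \<in> borel \<rightarrow>\<^sub>M borel"
begin

lemma measurable_first: "(\<lambda>x. x 0) \<in> paths N \<rightarrow>\<^sub>M borel"
  using N by (intro measurable_component_singleton) auto

lemma prob_space_sgn_flow: "prob_space (sgn_flow N g u)"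
  unfolding sgn_flow_def by (intro prob_space.prob_space_distr prob_space_sgn_law) simp

lemma first_marginal_sgn_flow: "distr (sgn_flow N g u) borel (\<lambda>x. x 0) = sgn_law u"
  unfolding sgn_flow_def using N measurable_first
  by (subst distr_distr) (auto simp: comp_def flow_def intro!: distr_id2)

lemma AE_sgn_flow: "AE x in sgn_flow N g u. x 0 \<in> {u, - u} \<and> (\<forall>i\<in>{1..<N}. x i = g (x 0))"
proof -
  note measurable_first [measurable]
  \<comment> \<open>Transferring an almost sure statement through \<open>distr\<close> by
    \<open>AE_distr_iff\<close> requires a measurable event; equality of two points is the zero set
    of their difference.\<close>
  have eq: "{x \<in> space (paths N). x i = g (x 0)} \<in> sets (paths N)" if "i \<in> {1..<N}" for i
  proof -
    have [measurable]: "(\<lambda>x. x i) \<in> paths N \<rightarrow>\<^sub>M borel"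
      using that by (intro measurable_component_singleton) auto
    have "(\<lambda>x. x i - g (x 0)) \<in> paths N \<rightarrow>\<^sub>M borel"
      by (intro borel_measurable_diff measurable_compose[OF measurable_first g]) fact
    then have "(\<lambda>x. x i - g (x 0)) -` {0} \<inter> space (paths N) \<in> sets (paths N)"
      by (rule measurable_sets) simp
    also have "(\<lambda>x. x i - g (x 0)) -` {0} \<inter> space (paths N) = {x \<in> space (paths N). x i = g (x 0)}"
      by auto
    finally show ?thesis .
  qed
  have "(\<lambda>x. x 0) -` {u, - u} \<inter> space (paths N) \<in> sets (paths N)"
    by (rule measurable_sets[OF measurable_first]) simp
  also have "(\<lambda>x. x 0) -` {u, - u} \<inter> space (paths N) = {x \<in> space (paths N). x 0 \<in> {u, - u}}"
    by blast
  finally have first: "{x \<in> space (paths N). x 0 \<in> {u, - u}} \<in> sets (paths N)" .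
  have "{x \<in> space (paths N). \<forall>i\<in>{1..<N}. x i = g (x 0)} \<in> sets (paths N)"
    by (rule sets.sets_Collect_finite_All[OF eq]) simp_all
  with first have "{x \<in> space (paths N). x 0 \<in> {u, - u}}
      \<inter> {x \<in> space (paths N). \<forall>i\<in>{1..<N}. x i = g (x 0)} \<in> sets (paths N)"
    by (rule sets.Int)
  also have "{x \<in> space (paths N). x 0 \<in> {u, - u}} \<inter> {x \<in> space (paths N). \<forall>i\<in>{1..<N}. x i = g (x 0)}
      = {x \<in> space (paths N). x 0 \<in> {u, - u} \<and> (\<forall>i\<in>{1..<N}. x i = g (x 0))}"
    by blast
  finally have "{x \<in> space (paths N). x 0 \<in> {u, - u} \<and> (\<forall>i\<in>{1..<N}. x i = g (x 0))} \<in> sets (paths N)" .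
  moreover have "AE a in sgn_law u. flow N g a 0 \<in> {u, - u} \<and> (\<forall>i\<in>{1..<N}. flow N g a i = g (flow N g a 0))"
    using AE_sgn_law by (rule eventually_mono) (simp add: flow_def N)
  ultimately show ?thesis
    unfolding sgn_flow_def by (simp only: AE_distr_iff[OF measurable_flow[OF g measurable_ident_sets[OF sets_sgn_law]]])
qed

text \<open>The later summands are all equal. The lemma is applied to single paths and to
  differences of two paths.\<close>

lemma path_pnormp_sgn_flow:
  assumes "\<forall>i\<in>{1..<N}. x i = a"
  shows "path_pnormp N p x = pnormp p (x 0) + real (N - 1) * pnormp p a"
proof -
  have "path_pnormp N p x = (\<Sum>i\<in>insert 0 {1..<N}. pnormp p (x i))"
    unfolding path_pnormp_def using N by (intro sum.cong) auto
  also have "\<dots> = pnormp p (x 0) + (\<Sum>i\<in>{1..<N}. pnormp p a)"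
    using assms by (subst sum.insert) auto
  finally show ?thesis by simp
qed

lemma sgn_flow_in_Pp: "sgn_flow N g u \<in> Pp N p"
proof -
  interpret prob_space "sgn_flow N g u" by (rule prob_space_sgn_flow)
  \<comment> \<open>Adding the costs of both possible values of \<open>g\<close> bounds each of the
    two paths that carry the law.\<close>
  let ?B = "pnormp p u + real (N - 1) * (pnormp p (g u) + pnormp p (g (- u)))"
  have "(\<integral>\<^sup>+ x. ennreal (path_pnormp N p x) \<partial>sgn_flow N g u) \<le> (\<integral>\<^sup>+ x. ennreal ?B \<partial>sgn_flow N g u)"
  proof (intro nn_integral_mono_AE, rule eventually_mono[OF AE_sgn_flow])
    fix x assume x: "x 0 \<in> {u, - u} \<and> (\<forall>i\<in>{1..<N}. x i = g (x 0))"
    then have "path_pnormp N p x = pnormp p (x 0) + real (N - 1) * pnormp p (g (x 0))"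
      by (intro path_pnormp_sgn_flow) auto
    also have "\<dots> \<le> ?B"
      using x by (intro add_mono mult_left_mono) auto
    finally show "ennreal (path_pnormp N p x) \<le> ennreal ?B"
      by (rule ennreal_leI)
  qed
  also have "\<dots> < \<infinity>"
    by (simp add: emeasure_space_1)
  finally show ?thesis
    by (simp add: Pp_def prob_space_axioms)
qed

section \<open>Upper and lower bounds over triangular optimal couplings\<close>

lemma first_marginal_triangular_optimal:
  assumes "\<pi> \<in> triangular_optimal N p \<mu> \<nu>" "prob_space \<mu>"
    and "sets \<mu> = sets (paths N)" "sets \<nu> = sets (paths N)"
  shows "Wp_optimal p (distr \<mu> borel (\<lambda>x. x 0)) (distr \<nu> borel (\<lambda>x. x 0))
           (distr \<pi> borel (\<lambda>z. (fst z 0, snd z 0)))"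
proof -
  obtain K\<^sub>\<mu> K\<^sub>\<nu> K\<^sub>\<pi> where dis: "disintegration N \<mu> K\<^sub>\<mu>" "disintegration N \<nu> K\<^sub>\<nu>"
      "disintegration N (distr \<pi> (paths N) (zip_paths N)) K\<^sub>\<pi>"
    and opt: "AE (x, y) in \<pi>. \<forall>k<N.
        Wp_optimal p (K\<^sub>\<mu> k (restrict x {0..<k})) (K\<^sub>\<nu> k (restrict y {0..<k})) (K\<^sub>\<pi> k (zip_paths k (x, y)))"
    and \<pi>: "\<pi> \<in> couplings \<mu> \<nu>"
    using assms(1) by (auto simp: triangular_optimal_def)
  interpret \<pi>: prob_space \<pi>
    using \<pi> assms(2) by (rule prob_space_coupling)
  have sets_\<pi> [measurable_cong]: "sets \<pi> = sets (paths N \<Otimes>\<^sub>M paths N)"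
    using \<pi> assms(3,4) by (auto simp: couplings_def cong: sets_pair_measure_cong)
  \<comment> \<open>At time 0 both histories are empty, so the condition no longer depends on
    \<open>z\<close>; on a probability space it then holds outright.\<close>
  have "AE z in \<pi>. Wp_optimal p (K\<^sub>\<mu> 0 (\<lambda>_. undefined)) (K\<^sub>\<nu> 0 (\<lambda>_. undefined)) (K\<^sub>\<pi> 0 (\<lambda>_. undefined))"
    using opt by eventually_elim (use N in \<open>force simp: zip_paths_def restrict_def\<close>)
  then have "Wp_optimal p (K\<^sub>\<mu> 0 (\<lambda>_. undefined)) (K\<^sub>\<nu> 0 (\<lambda>_. undefined)) (K\<^sub>\<pi> 0 (\<lambda>_. undefined))"
    by simp
  moreover have "distr (distr \<pi> (paths N) (zip_paths N)) borel (\<lambda>z. z 0) = distr \<pi> borel (\<lambda>z. (fst z 0, snd z 0))"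
  proof (subst distr_distr)
    show "(\<lambda>z. z 0) \<in> paths N \<rightarrow>\<^sub>M borel"
      using N by (intro measurable_component_singleton) auto
    show "zip_paths N \<in> \<pi> \<rightarrow>\<^sub>M paths N" by measurable
    show "distr \<pi> borel ((\<lambda>z. z 0) \<circ> zip_paths N) = distr \<pi> borel (\<lambda>z. (fst z 0, snd z 0))"
      using N by (intro distr_cong) (auto simp: zip_paths_def)
  qed
  ultimately show ?thesis
    using dis N by (simp add: disintegration_first_marginal)
qed

text \<open>By \<open>less\<close>, equal signs are strictly cheaper at time 0, so optimality there
  forces them almost surely. Equal signs have the same image under \<open>g\<close>, hence the later
  points contribute nothing.\<close>

lemma KRp_sgn_flow_le:
  assumes p: "0 < p" and less: "pnormp p (u - w) < pnormp p (u + w)"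
    and gv: "g u = v" "g w = v" "g (- u) = - v" "g (- w) = - v"
  shows "KRp N p (sgn_flow N g u) (sgn_flow N g w) \<le> eroot p (ennreal (pnormp p (u - w)))"
  unfolding KRp_def
proof (rule SUP_least)
  let ?c = "pnormp p (u - w)"
  fix \<pi> assume \<pi>: "\<pi> \<in> triangular_optimal N p (sgn_flow N g u) (sgn_flow N g w)"
  then have cpl: "\<pi> \<in> couplings (sgn_flow N g u) (sgn_flow N g w)"
    by (simp add: triangular_optimal_def)
  interpret \<pi>: prob_space \<pi>
    using cpl prob_space_sgn_flow by (rule prob_space_coupling)
  have sets_\<pi> [measurable_cong]: "sets \<pi> = sets (paths N \<Otimes>\<^sub>M paths N)"
    using cpl by (auto simp: couplings_def cong: sets_pair_measure_cong)
  note measurable_first [measurable]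
  let ?\<gamma> = "distr \<pi> borel (\<lambda>z. (fst z 0, snd z 0))"
  \<comment> \<open>The competitor that matches equal signs bounds the optimal cost at time 0 by
    \<open>?c\<close>.\<close>
  let ?\<delta> = "distr (measure_pmf sgn_pmf) (borel \<Otimes>\<^sub>M borel) (\<lambda>s. (s *\<^sub>R u, s *\<^sub>R w))"
  have \<delta>: "?\<delta> \<in> couplings (sgn_law u) (sgn_law w)"
    by (rule distr_Pair_in_couplings) (simp_all add: sgn_law_def)
  have "(\<integral>\<^sup>+ (x, y). ennreal (pnormp p (x - y)) \<partial>?\<delta>) = (\<integral>\<^sup>+ s. ennreal (pnormp p (s *\<^sub>R u - s *\<^sub>R w)) \<partial>measure_pmf sgn_pmf)"
    by (subst nn_integral_distr) (auto simp: split_beta space_pair_measure)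
  also have "\<dots> = (\<integral>\<^sup>+ s. ennreal ?c \<partial>measure_pmf sgn_pmf)"
    by (intro nn_integral_cong_AE) (auto simp: AE_measure_pmf_iff pnormp_diff_commute)
  finally have \<delta>_cost: "(\<integral>\<^sup>+ (x, y). ennreal (pnormp p (x - y)) \<partial>?\<delta>) = ennreal ?c"
    by simp
  have "Wp_optimal p (sgn_law u) (sgn_law w) ?\<gamma>"
    using first_marginal_triangular_optimal[OF \<pi> prob_space_sgn_flow]
    by (simp add: first_marginal_sgn_flow)
  then have "eroot p (\<integral>\<^sup>+ (x, y). ennreal (pnormp p (x - y)) \<partial>?\<gamma>) = Wp p (sgn_law u) (sgn_law w)"
    by (simp add: Wp_optimal_def)
  also have "\<dots> \<le> eroot p (ennreal ?c)"
    unfolding Wp_def \<delta>_cost[symmetric] by (rule INF_lower[OF \<delta>])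
  finally have "(\<integral>\<^sup>+ (x, y). ennreal (pnormp p (x - y)) \<partial>?\<gamma>) \<le> ennreal ?c"
    by (rule le_if_eroot_le[OF p]) simp
  also have "(\<integral>\<^sup>+ (x, y). ennreal (pnormp p (x - y)) \<partial>?\<gamma>) = (\<integral>\<^sup>+ z. ennreal (pnormp p (fst z 0 - snd z 0)) \<partial>\<pi>)"
    unfolding borel_prod[symmetric] by (subst nn_integral_distr) (auto simp: split_beta)
  finally have le: "(\<integral>\<^sup>+ z. ennreal (pnormp p (fst z 0 - snd z 0)) \<partial>\<pi>) \<le> ennreal ?c" .
  have supp: "AE z in \<pi>. (fst z 0 \<in> {u, - u} \<and> (\<forall>i\<in>{1..<N}. fst z i = g (fst z 0))) \<and>
      (snd z 0 \<in> {w, - w} \<and> (\<forall>i\<in>{1..<N}. snd z i = g (snd z 0)))"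
    using cpl AE_sgn_flow AE_sgn_flow by (rule couplings_AE)
  have sym: "pnormp p (- u - w) = pnormp p (u + w)" "pnormp p (- u + w) = ?c" "pnormp p (w - u) = ?c"
    using pnormp_minus[of p "u + w"] pnormp_minus[of p "u - w"] by (simp_all add: algebra_simps)
  \<comment> \<open>The first alternative is the case of equal signs, the second that of opposite
    signs.\<close>
  have cost: "(pnormp p (a - b) = ?c \<and> g a = g b) \<or> ?c < pnormp p (a - b)"
    if a: "a \<in> {u, - u}" and b: "b \<in> {w, - w}" for a b
  proof -
    consider "a = u" "b = w" | "a = u" "b = - w" | "a = - u" "b = w" | "a = - u" "b = - w"
      using a b by blast
    then show ?thesis
    proof cases
      case 1 then show ?thesis by (simp add: gv)
    next
      case 2 then show ?thesis using less by simp
    next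
      case 3 then show ?thesis using less by (simp only: sym simp_thms)
    next
      case 4 then show ?thesis by (simp only: gv sym diff_minus_eq_add simp_thms)
    qed
  qed
  have "AE z in \<pi>. ennreal (pnormp p (fst z 0 - snd z 0)) = ennreal ?c"
  proof (rule \<pi>.AE_eq_if_nn_integral_le[OF _ _ le])
    show "AE z in \<pi>. ennreal ?c \<le> ennreal (pnormp p (fst z 0 - snd z 0))"
      using supp by eventually_elim (metis cost ennreal_leI order_refl less_imp_le)
  qed measurable
  with supp have "AE z in \<pi>. ennreal (path_pnormp N p (\<lambda>i. fst z i - snd z i)) = ennreal ?c"
  proof eventually_elim
    case (elim z)
    then have c: "pnormp p (fst z 0 - snd z 0) = ?c"
      by simp
    \<comment> \<open>Cost exactly \<open>?c\<close> rules out the strict alternative in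
      \<open>cost\<close>.\<close>
    then have "g (fst z 0) = g (snd z 0)"
      using elim(1) cost[of "fst z 0" "snd z 0"] by simp
    then have "path_pnormp N p (\<lambda>i. fst z i - snd z i) = pnormp p (fst z 0 - snd z 0) + real (N - 1) * pnormp p 0"
      using elim(1) path_pnormp_sgn_flow[of "\<lambda>i. fst z i - snd z i" 0] by simp
    with c show ?case by simp
  qed
  then have "(\<integral>\<^sup>+ z. ennreal (path_pnormp N p (\<lambda>i. fst z i - snd z i)) \<partial>\<pi>) = (\<integral>\<^sup>+ z. ennreal ?c \<partial>\<pi>)"
    by (rule nn_integral_cong_AE)
  then show "eroot p (\<integral>\<^sup>+ (x, y). ennreal (path_pnormp N p (\<lambda>i. x i - y i)) \<partial>\<pi>) \<le> eroot p (ennreal ?c)"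
    by (simp add: case_prod_unfold \<pi>.emeasure_space_1)
qed

text \<open>By \<open>eq\<close>, the cost at time 0 does not see the signs, so matching opposite
  signs is optimal. The later conditional laws are Dirac masses at \<open>v\<close> and
  \<open>- v\<close>, which puts each later pair of points \<open>2 *\<^sub>R v\<close> apart up to
  sign.\<close>

lemma KRp_sgn_flow_ge:
  assumes eq: "pnormp p (u - w) = pnormp p (u + w)"
    and gv: "g u = v" "g w = v" "g (- u) = - v" "g (- w) = - v"
  shows "eroot p (ennreal (pnormp p (u + w) + real (N - 1) * pnormp p (2 *\<^sub>R v)))
    \<le> KRp N p (sgn_flow N g u) (sgn_flow N g w)"
proof -
  let ?c = "pnormp p (u + w) + real (N - 1) * pnormp p (2 *\<^sub>R v)"
  let ?\<gamma> = "distr (measure_pmf sgn_pmf) borel (\<lambda>s. (s *\<^sub>R u, - (s *\<^sub>R w)))"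
  let ?\<pi> = "distr (measure_pmf sgn_pmf) (paths N \<Otimes>\<^sub>M paths N)
    (\<lambda>s. (flow N g (s *\<^sub>R u), flow N g (- (s *\<^sub>R w))))"
  have gg: "map_prod g g \<in> borel \<rightarrow>\<^sub>M borel"
    unfolding borel_prod[symmetric] map_prod_def by measurable
  have \<pi>: "?\<pi> \<in> couplings (sgn_flow N g u) (sgn_flow N g w)"
  proof (rule distr_Pair_in_couplings)
    show "distr (measure_pmf sgn_pmf) (paths N) (\<lambda>s. flow N g (s *\<^sub>R u)) = sgn_flow N g u"
      unfolding sgn_flow_def sgn_law_def by (subst distr_distr) (simp_all add: comp_def)
    show "distr (measure_pmf sgn_pmf) (paths N) (\<lambda>s. flow N g (- (s *\<^sub>R w))) = sgn_flow N g w"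
      unfolding sgn_flow_def sgn_law_uminus[symmetric] by (subst distr_distr) (simp_all add: comp_def)
  qed measurable
  have \<gamma>: "?\<gamma> \<in> couplings (sgn_law u) (sgn_law w)"
    unfolding borel_prod[symmetric]
    by (rule distr_Pair_in_couplings) (simp_all add: sgn_law_uminus sgn_law_def)
  have sym: "pnormp p (- u - w) = pnormp p (u + w)" "pnormp p (- u + w) = pnormp p (u + w)" "pnormp p (w - u) = pnormp p (u + w)"
    using pnormp_minus[of p "u + w"] pnormp_minus[of p "u - w"] eq by (simp_all add: algebra_simps)
  have opt0: "Wp_optimal p (sgn_law u) (sgn_law w) ?\<gamma>"
    by (rule Wp_optimal_if_cost_constant[OF \<gamma> prob_space_sgn_law AE_sgn_law AE_sgn_law, where c = "pnormp p (u + w)"])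
       (auto simp: sym eq)
  have opt: "Wp_optimal p (return borel a) (return borel b) (return borel (a, b))" for a b :: "real ^ 'd"
  proof (rule Wp_optimal_if_cost_constant)
    have sets: "sets borel = sets (return borel a \<Otimes>\<^sub>M return borel b)"
      unfolding borel_prod[symmetric] by (intro sets_pair_measure_cong) simp_all
    have "distr (return borel (a, b)) borel fst = return borel a"
         "distr (return borel (a, b)) borel snd = return borel b"
      by (subst distr_return; simp add: borel_prod[symmetric] space_pair_measure)+
    moreover have "distr (return borel (a, b)) (return borel a) fst = distr (return borel (a, b)) borel fst"
         "distr (return borel (a, b)) (return borel b) snd = distr (return borel (a, b)) borel snd"
      by (intro distr_cong; simp)+
    ultimately show "return borel (a, b) \<in> couplings (return borel a) (return borel b)"
      using sets by (simp add: couplings_def)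
    show "AE x in return borel a. x \<in> {a}" "AE x in return borel b. x \<in> {b}"
      by (auto simp: AE_return)
  qed (auto intro: prob_space_return)
  have pair_meas: "(\<lambda>s. (s *\<^sub>R u, - (s *\<^sub>R w))) \<in> measure_pmf sgn_pmf \<rightarrow>\<^sub>M borel"
    "(\<lambda>s. (flow N g (s *\<^sub>R u), flow N g (- (s *\<^sub>R w)))) \<in> measure_pmf sgn_pmf \<rightarrow>\<^sub>M paths N \<Otimes>\<^sub>M paths N"
    unfolding borel_prod[symmetric] by measurable
  \<comment> \<open>Zipping two flows gives a flow of pairs under \<open>map_prod g g\<close>, so
    \<open>disintegration_flow\<close> also yields the kernels of the coupling.\<close>
  have zip: "zip_paths N (flow N g a, flow N g b) = flow N (map_prod g g) (a, b)" for a b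
    by (auto simp: zip_paths_def flow_def fun_eq_iff)
  have "distr ?\<pi> (paths N) (zip_paths N)
      = distr (measure_pmf sgn_pmf) (paths N) (\<lambda>s. flow N (map_prod g g) (s *\<^sub>R u, - (s *\<^sub>R w)))"
    by (subst distr_distr[OF measurable_zip_paths pair_meas(2)]) (simp add: comp_def zip)
  also have "\<dots> = distr ?\<gamma> (paths N) (flow N (map_prod g g))"
    by (subst distr_distr[OF measurable_flow[OF gg measurable_ident_sets[OF refl]] pair_meas(1)]) (simp add: comp_def)
  finally have "distr ?\<pi> (paths N) (zip_paths N) = distr ?\<gamma> (paths N) (flow N (map_prod g g))" .
  moreover have "disintegration N \<dots> (flow_kernel ?\<gamma> (map_prod g g))"
    by (intro disintegration_flow gg N prob_space.prob_space_distr prob_space_measure_pmf pair_meas(1)) simp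
  ultimately have dis: "disintegration N (distr ?\<pi> (paths N) (zip_paths N)) (flow_kernel ?\<gamma> (map_prod g g))"
    by simp
  have "?\<pi> \<in> triangular_optimal N p (sgn_flow N g u) (sgn_flow N g w)"
    unfolding triangular_optimal_def
  proof (intro CollectI conjI exI)
    show "disintegration N (sgn_flow N g u) (flow_kernel (sgn_law u) g)" for u
      unfolding sgn_flow_def by (intro disintegration_flow prob_space_sgn_law g N) simp
    then show "disintegration N (sgn_flow N g w) (flow_kernel (sgn_law w) g)" .
    show "AE (x, y) in ?\<pi>. \<forall>k<N. Wp_optimal p (flow_kernel (sgn_law u) g k (restrict x {0..<k}))
        (flow_kernel (sgn_law w) g k (restrict y {0..<k}))
        (flow_kernel ?\<gamma> (map_prod g g) k (zip_paths k (x, y)))"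
      by (auto simp: flow_kernel_def opt0 opt zip_paths_def)
  qed (fact \<pi> dis)+
  then have "eroot p (\<integral>\<^sup>+ (x, y). ennreal (path_pnormp N p (\<lambda>i. x i - y i)) \<partial>?\<pi>)
      \<le> KRp N p (sgn_flow N g u) (sgn_flow N g w)"
    unfolding KRp_def by (rule SUP_upper)
  moreover have "(\<integral>\<^sup>+ (x, y). ennreal (path_pnormp N p (\<lambda>i. x i - y i)) \<partial>?\<pi>) = ennreal ?c"
  proof -
    have m: "(\<lambda>z. ennreal (path_pnormp N p (\<lambda>i. fst z i - snd z i))) \<in> borel_measurable (paths N \<Otimes>\<^sub>M paths N)"
    proof -
      have [measurable]: "(\<lambda>x. x i) \<in> paths N \<rightarrow>\<^sub>M borel" if "i \<in> {..<N}" for i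
        using that by (intro measurable_component_singleton) auto
      show ?thesis
        unfolding path_pnormp_def by measurable
    qed
    have "(\<integral>\<^sup>+ (x, y). ennreal (path_pnormp N p (\<lambda>i. x i - y i)) \<partial>?\<pi>)
        = (\<integral>\<^sup>+ s. ennreal (path_pnormp N p (\<lambda>i. flow N g (s *\<^sub>R u) i - flow N g (- (s *\<^sub>R w)) i)) \<partial>measure_pmf sgn_pmf)"
      unfolding split_beta by (subst nn_integral_distr[OF pair_meas(2)]) (simp_all add: m)
    also have "\<dots> = (\<integral>\<^sup>+ s. ennreal ?c \<partial>measure_pmf sgn_pmf)"
    proof (intro nn_integral_cong_AE, unfold AE_measure_pmf_iff, rule ballI)
      fix s assume s: "s \<in> set_pmf sgn_pmf"
      have "path_pnormp N p (\<lambda>i. flow N g (s *\<^sub>R u) i - flow N g (- (s *\<^sub>R w)) i)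
          = pnormp p (flow N g (s *\<^sub>R u) 0 - flow N g (- (s *\<^sub>R w)) 0)
            + real (N - 1) * pnormp p (g (s *\<^sub>R u) - g (- (s *\<^sub>R w)))"
        by (rule path_pnormp_sgn_flow[where x = "\<lambda>i. flow N g (s *\<^sub>R u) i - flow N g (- (s *\<^sub>R w)) i"])
           (auto simp: flow_def)
      \<comment> \<open>The sign \<open>s\<close> only multiplies the differences
        \<open>u + w\<close> and \<open>2 *\<^sub>R v\<close>, and the cost is even.\<close>
      also have "\<dots> = ?c"
        using s N pnormp_minus[of p "2 *\<^sub>R v"] by (auto simp: flow_def gv sym scaleR_2)
      finally show "ennreal (path_pnormp N p (\<lambda>i. flow N g (s *\<^sub>R u) i - flow N g (- (s *\<^sub>R w)) i)) = ennreal ?c"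
        by simp
    qed
    finally show ?thesis by simp
  qed
  ultimately show ?thesis by simp
qed

end

section \<open>The three laws and the strict gap\<close>

theorem lemmaA6:
  fixes N :: nat and p :: real
  assumes "CARD('d::finite) > 1" and "N > 1" and "p \<ge> 1"
  shows "\<exists>\<mu> \<nu> \<eta> :: (nat \<Rightarrow> real ^ 'd) measure.
           \<mu> \<in> Pp N p \<and> \<nu> \<in> Pp N p \<and> \<eta> \<in> Pp N p \<and>
           KRp N p \<mu> \<eta> > KRp N p \<mu> \<nu> + KRp N p \<nu> \<eta>"
proof -
  obtain i j :: 'd where "i \<noteq> j"
    using assms(1) by (metis (full_types) One_nat_def UNIV_I card_le_Suc0_iff_eq finite_code not_less)
  define e where "e a b = a *\<^sub>R axis i 1 + b *\<^sub>R axis j (1::real)" for a b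
  have pn: "pnormp p (e a b) = \<bar>a\<bar> powr p + \<bar>b\<bar> powr p" for a b
    unfolding e_def by (rule pnormp_axis2[OF \<open>i \<noteq> j\<close>])
  have e_simps: "e a b - e a' b' = e (a - a') (b - b')" "e a b + e a' b' = e (a + a') (b + b')"
      "- e a b = e (- a) (- b)" "c *\<^sub>R e a b = e (c * a) (c * b)" for a b a' b' c
    by (simp_all add: e_def algebra_simps)
  have e_sum: "e a b $ i + e a b $ j = a + b" for a b
    using \<open>i \<noteq> j\<close> by (simp add: e_def axis_def)
  \<comment> \<open>The sum of the two coordinates is 1 at all three choices of the first point and
    -1 at their negatives, so a single map \<open>g\<close> reads off the sign for all three
    laws.\<close>
  define g :: "real ^ 'd \<Rightarrow> real ^ 'd" where "g x = (if 0 < x $ i + x $ j then e 1 0 else - e 1 0)" for x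
  have g: "g \<in> borel \<rightarrow>\<^sub>M borel"
    unfolding g_def by measurable
  have g_e: "g (e a b) = (if 0 < a + b then e 1 0 else - e 1 0)" for a b
    by (simp add: g_def e_sum)
  let ?M = "\<lambda>a b. sgn_flow N g (e a b)"
  let ?c = "(1/2) powr p + (1/2) powr p"
  have N: "0 < N" and p: "0 < p"
    using assms by auto
  \<comment> \<open>In both steps through the midpoint, equal signs differ by 1/2 in each of the two
    coordinates, opposite signs by 3/2 in one and 1/2 in the other. The hypothesis
    \<open>less\<close> thus reduces to this inequality.\<close>
  have half: "(1/2) powr p < (3/2) powr p"
    using p by (intro powr_less_mono2) auto
  have "KRp N p (?M 1 0) (?M (1/2) (1/2)) \<le> eroot p (ennreal (pnormp p (e 1 0 - e (1/2) (1/2))))"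
    by (rule KRp_sgn_flow_le[OF N g p, where v = "e 1 0"]) (use half in \<open>simp_all add: e_simps g_e pn\<close>)
  then have le1: "KRp N p (?M 1 0) (?M (1/2) (1/2)) \<le> eroot p (ennreal ?c)"
    by (simp add: e_simps pn)
  have "KRp N p (?M (1/2) (1/2)) (?M 0 1) \<le> eroot p (ennreal (pnormp p (e (1/2) (1/2) - e 0 1)))"
    by (rule KRp_sgn_flow_le[OF N g p, where v = "e 1 0"]) (use half in \<open>simp_all add: e_simps g_e pn\<close>)
  then have le2: "KRp N p (?M (1/2) (1/2)) (?M 0 1) \<le> eroot p (ennreal ?c)"
    by (simp add: e_simps pn)
  \<comment> \<open>Sum and difference of the two unit vectors both have cost 2, since their
    supports are disjoint.\<close>
  have "eroot p (ennreal (pnormp p (e 1 0 + e 0 1) + real (N - 1) * pnormp p (2 *\<^sub>R e 1 0))) \<le> KRp N p (?M 1 0) (?M 0 1)"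
    by (rule KRp_sgn_flow_ge[OF N g]) (simp_all add: e_simps g_e pn)
  then have ge: "eroot p (ennreal (2 + real (N - 1) * 2 powr p)) \<le> KRp N p (?M 1 0) (?M 0 1)"
    using p by (simp add: e_simps pn)
  \<comment> \<open>Each step has length half of \<open>2 powr (1/p)\<close>. The two steps together
    therefore give exactly the contribution of time 0 to the direct distance, and the gap comes from
    the later times, of which there is at least one.\<close>
  have "?c = 2 * (1/2) powr p" by simp
  then have "?c powr (1/p) = 2 powr (1/p) * ((1/2) powr p) powr (1/p)"
    by (simp only: powr_mult) 
  then have "?c powr (1/p) = 2 powr (1/p) / 2"
    using p by (simp add: powr_powr)
  then have "eroot p (ennreal ?c) + eroot p (ennreal ?c) = ennreal (2 powr (1/p))"
    by (simp add: eroot_ennreal ennreal_plus[symmetric] del: ennreal_plus)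
  also have "\<dots> < ennreal ((2 + real (N - 1) * 2 powr p) powr (1/p))"
  proof -
    have "0 < real (N - 1) * 2 powr p"
      using assms(2) by simp
    then have "2 < 2 + real (N - 1) * 2 powr p"
      by linarith
    then have "2 powr (1/p) < (2 + real (N - 1) * 2 powr p) powr (1/p)"
      by (rule powr_less_mono2[rotated 2]) (use p in auto)
    then show ?thesis
      by (subst ennreal_less_iff) simp_all
  qed
  also have "\<dots> = eroot p (ennreal (2 + real (N - 1) * 2 powr p))"
    by (rule eroot_ennreal[symmetric]) (intro add_nonneg_nonneg mult_nonneg_nonneg; simp)
  finally have "eroot p (ennreal ?c) + eroot p (ennreal ?c) < KRp N p (?M 1 0) (?M 0 1)"
    using ge by (rule order_less_le_trans)
  then have "KRp N p (?M 1 0) (?M (1/2) (1/2)) + KRp N p (?M (1/2) (1/2)) (?M 0 1) < KRp N p (?M 1 0) (?M 0 1)"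
    using add_mono[OF le1 le2] by (rule order_le_less_trans[rotated])
  then show ?thesis
    using sgn_flow_in_Pp[OF N g] by blast
qed

end
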